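(* Let $\mathcal{H}$ be a Hilbert space, let $\rho\in(0,\infty)$, and let $T, A\in \mathcal{B}(\mathcal{H})$ belong to the class $\zeta_\rho$ with $\|T\|=\rho$. If $U_T$ and $U_A$ are unitary $\rho$-dilations of $T$ and $A$ respectively on a common Hilbert space $\mathcal{K}\supseteq \mathcal{H}$, then $U_T\perp_B U_A$ whenever $T\perp_B A$.
   Context: All Hilbert spaces are complex and separable, and all operators are bounded and linear. For operators $X,Y$ on the same Hilbert space, $X\perp_B Y$ (Birkhoff-James orthogonality) means $\|X+\lambda Y\|\ge\|X\|$ for every $\lambda\in\mathbb{C}$ (operator norm). For $\rho>0$, a unitary operator $U$ on a Hilbert space $\mathcal{K}\supseteq\mathcal{H}$ is a unitary $\rho$-dilation of $T\in\mathcal{B}(\mathcal{H})$ if $T^n=\rho P_{\mathcal{H}}U^n|_{\mathcal{H}}$ for every integer $n\ge 1$, where $P_{\mathcal{H}}:\mathcal{K}\to\mathcal{H}$ is the orthogonal projection. The class $\zeta_\rho$ consists of all operators that possess a unitary $\rho$-dilation. *)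

theory Defs
  imports "HOL-Analysis.Analysis"
begin

text \<open>
  Complex inner product spaces, layered on the real ones: the real inner product is the real part
  of the complex one, so norm, metric and topology are those induced by the complex inner product.
  The complex inner product is linear in its first argument.
\<close>

class complex_inner = real_inner +
  fixes scaleC :: "complex \<Rightarrow> 'a \<Rightarrow> 'a" (infixr "*\<^sub>C" 75)
    and cinner :: "'a \<Rightarrow> 'a \<Rightarrow> complex"
  assumes scaleC_add_right: "a *\<^sub>C (x + y) = a *\<^sub>C x + a *\<^sub>C y"
    and scaleC_add_left: "(a + b) *\<^sub>C x = a *\<^sub>C x + b *\<^sub>C x"
    and scaleC_scaleC: "a *\<^sub>C b *\<^sub>C x = (a * b) *\<^sub>C x"
    and scaleC_of_real: "of_real r *\<^sub>C x = r *\<^sub>R x"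
    and cinner_add_left: "cinner (x + y) z = cinner x z + cinner y z"
    and cinner_scaleC_left: "cinner (a *\<^sub>C x) y = a * cinner x y"
    and cinner_commute: "cinner x y = cnj (cinner y x)"
    and Re_cinner: "Re (cinner x y) = inner x y"

class separable_complex_hilbert = complex_inner + complete_space +
  assumes countable_dense_subset: "\<exists>D. countable D \<and> (\<forall>x. \<forall>e>0. \<exists>d\<in>D. dist d x < e)"

instantiation complex :: separable_complex_hilbert
begin

definition scaleC_complex :: "complex \<Rightarrow> complex \<Rightarrow> complex"
  where "scaleC_complex a x = a * x"

definition cinner_complex :: "complex \<Rightarrow> complex \<Rightarrow> complex"
  where "cinner_complex x y = x * cnj y"

instance
proof
  obtain D :: "complex set"
    where "countable D" and D: "\<And>X. open X \<Longrightarrow> X \<noteq> {} \<Longrightarrow> \<exists>d\<in>D. d \<in> X"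
    by (metis countable_dense_setE)
  moreover have "\<exists>d\<in>D. dist d x < e" if "e > 0" for x e
    using D[of "ball x e"] that by (auto simp: dist_commute)
  ultimately show "\<exists>D :: complex set. countable D \<and> (\<forall>x. \<forall>e>0. \<exists>d\<in>D. dist d x < e)"
    by blast
qed (simp_all add: scaleC_complex_def cinner_complex_def inner_complex_def scaleR_conv_of_real
      algebra_simps)

end

definition bounded_clinear ::
    "('a::complex_inner \<Rightarrow> 'b::complex_inner) \<Rightarrow> bool"
  where "bounded_clinear T \<longleftrightarrow> bounded_linear T \<and> (\<forall>c x. T (c *\<^sub>C x) = c *\<^sub>C T x)"

definition bj_orthogonal ::
    "('a::complex_inner \<Rightarrow> 'a) \<Rightarrow> ('a \<Rightarrow> 'a) \<Rightarrow> bool"  (infix "\<bottom>\<^sub>B" 50)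
  where "X \<bottom>\<^sub>B Y \<longleftrightarrow> (\<forall>c :: complex. onorm (\<lambda>x. X x + c *\<^sub>C Y x) \<ge> onorm X)"

definition unitary :: "('a::complex_inner \<Rightarrow> 'a) \<Rightarrow> bool"
  where "unitary U \<longleftrightarrow>
    bounded_clinear U \<and> surj U \<and> (\<forall>x y. cinner (U x) (U y) = cinner x y)"

definition isometric_embedding ::
    "('h::complex_inner \<Rightarrow> 'k::complex_inner) \<Rightarrow> bool"
  where "isometric_embedding J \<longleftrightarrow>
    bounded_clinear J \<and> (\<forall>x y. cinner (J x) (J y) = cinner x y)"

text \<open>Meaningful when \<open>S\<close> is a closed complex subspace of a Hilbert space.\<close>

definition orthogonal_projection :: "'a::complex_inner set \<Rightarrow> 'a \<Rightarrow> 'a"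
  where "orthogonal_projection S x = (THE p. p \<in> S \<and> (\<forall>y\<in>S. cinner (x - p) y = 0))"

text \<open>
  An inclusion of Hilbert spaces \<open>H \<subseteq> K\<close> is given by an isometric embedding \<open>J\<close> of the type \<open>'h\<close>
  into the type \<open>'k\<close>, which identifies \<open>H\<close> with the closed subspace \<open>range J\<close> of \<open>K\<close>.
\<close>

definition unitary_rho_dilation ::
    "real \<Rightarrow> ('h::separable_complex_hilbert \<Rightarrow> 'k::separable_complex_hilbert) \<Rightarrow>
     ('h \<Rightarrow> 'h) \<Rightarrow> ('k \<Rightarrow> 'k) \<Rightarrow> bool"
  where "unitary_rho_dilation \<rho> J T U \<longleftrightarrow>
    isometric_embedding J \<and> unitary U \<and>
    (\<forall>n\<ge>1. \<forall>h. J ((T ^^ n) h) = \<rho> *\<^sub>R orthogonal_projection (range J) ((U ^^ n) (J h)))"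

text \<open>
  The class of operators with a unitary \<open>\<rho>\<close>-dilation. HOL cannot quantify over the space \<open>K\<close> inside
  a definition, so its type is a parameter. Membership for an unspecified \<open>K\<close>, occurring as a
  hypothesis, is expressed by a type variable that occurs nowhere else: universal
  quantification over it outside the implication is existential quantification in the premise.
\<close>

definition zeta_class ::
    "'k::separable_complex_hilbert itself \<Rightarrow> real \<Rightarrow> ('h::separable_complex_hilbert \<Rightarrow> 'h) set"
  where "zeta_class K \<rho> =
    {T. bounded_clinear T \<and> (\<exists>(J :: 'h \<Rightarrow> 'k) U. unitary_rho_dilation \<rho> J T U)}"

end

theory Submission
  imports Defs
begin

text \<open>
  By the dilation equations for \<open>n = 1\<close> and linearity of the projection \<open>P\<close> onto \<open>H\<close>, the
  operator \<open>T + c A\<close> is \<open>\<rho>\<close> times the compression of \<open>U\<^sub>T + c U\<^sub>A\<close> to \<open>H\<close>. As \<open>P\<close> is a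
  contraction, \<open>\<parallel>T + c A\<parallel> \<le> \<rho> \<parallel>U\<^sub>T + c U\<^sub>A\<parallel>\<close> (\<open>onorm_pencil_le_dilation\<close>). If \<open>T \<bottom>\<^sub>B A\<close>, the left-hand side is at least
  \<open>\<parallel>T\<parallel> = \<rho>\<close>, so \<open>\<parallel>U\<^sub>T + c U\<^sub>A\<parallel> \<ge> 1 \<ge> \<parallel>U\<^sub>T\<parallel>\<close>. A smaller norm of \<open>T\<close> would give only a
  lower bound below \<open>1\<close>; the value \<open>\<rho>\<close>, the largest possible one, makes the factors cancel.

  The analytic input is that \<open>P\<close> really is a projection: the projection theorem for closed
  subspaces of a complete inner product space (\<open>closed_subspace_projection_exists\<close>), applied to
  the range of an isometry (\<open>orthogonal_projection_range\<close>).
\<close>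

section \<open>Orthogonal projections\<close>

text \<open>
  By the parallelogram law, two points of \<open>S\<close> that both nearly minimise the distance to \<open>x\<close> are
  close to each other, because their midpoint lies in \<open>S\<close> and cannot do better than the infimum.
  Hence the sets of near-minimisers shrink to a point by completeness, and a variation along \<open>S\<close>
  shows that the error at a minimiser is orthogonal to \<open>S\<close>.
\<close>

lemma closed_subspace_projection_exists:
  fixes S :: "'a::{real_inner,complete_space} set" and x :: 'a
  assumes S: "subspace S" and "closed S"
  shows "\<exists>p\<in>S. \<forall>y\<in>S. inner (x - p) y = 0"
proof -
  define d where "d = (INF s\<in>S. (norm (x - s))\<^sup>2)"
  have S0: "S \<noteq> {}" using subspace_0[OF S] by blast
  have bdd: "bdd_below ((\<lambda>s. (norm (x - s))\<^sup>2) ` S)"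
    by (rule bdd_belowI[of _ 0]) auto
  have d_le: "d \<le> (norm (x - s))\<^sup>2" if "s \<in> S" for s
    unfolding d_def by (rule cINF_lower[OF bdd that])
  define N where "N n = {s \<in> S. (norm (x - s))\<^sup>2 \<le> d + inverse (real (Suc n))}" for n
  have N_closed: "closed (N n)" for n
  proof -
    have "N n = S \<inter> {s. (norm (x - s))\<^sup>2 \<le> d + inverse (real (Suc n))}"
      by (auto simp: N_def)
    then show ?thesis
      using \<open>closed S\<close> by (simp add: closed_Int closed_Collect_le continuous_intros)
  qed
  have N_nonempty: "N n \<noteq> {}" for n
  proof -
    have "(INF s\<in>S. (norm (x - s))\<^sup>2) < d + inverse (real (Suc n))"
      by (simp add: d_def[symmetric])
    then obtain s where "s \<in> S" "(norm (x - s))\<^sup>2 < d + inverse (real (Suc n))"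
      using cINF_less_iff[OF S0 bdd] by blast
    then show ?thesis by (auto simp: N_def intro!: exI[of _ s])
  qed
  have N_anti: "N n \<subseteq> N m" if "m \<le> n" for m n
  proof -
    have "inverse (real (Suc n)) \<le> inverse (real (Suc m))"
      using that by (intro le_imp_inverse_le) auto
    then show ?thesis unfolding N_def by (auto simp del: of_nat_Suc intro: order_trans)
  qed
  have N_small: "\<exists>n. \<forall>s\<in>N n. \<forall>t\<in>N n. dist s t < e" if "e > 0" for e
  proof -
    have "0 < e\<^sup>2 / 4" using that by simp
    then obtain n where n: "inverse (real (Suc n)) < e\<^sup>2 / 4"
      using reals_Archimedean by blast
    have "dist s t < e" if st: "s \<in> N n" "t \<in> N n" for s t
    proof -
      define m where "m = (1/2) *\<^sub>R (s + t)"
      have "m \<in> S"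
        unfolding m_def using st S by (auto simp: N_def intro: subspace_scale subspace_add)
      have "(norm (s - t))\<^sup>2 + 4 * (norm (x - m))\<^sup>2
          = 2 * (norm (x - s))\<^sup>2 + 2 * (norm (x - t))\<^sup>2"
        unfolding m_def power2_norm_eq_inner
        by (simp add: algebra_simps inner_commute)
      then have "(norm (s - t))\<^sup>2 \<le> 4 * inverse (real (Suc n))"
        using st d_le[OF \<open>m \<in> S\<close>] by (simp add: N_def)
      then have "(norm (s - t))\<^sup>2 < e\<^sup>2" using n by simp
      then show ?thesis using \<open>e > 0\<close> by (simp add: dist_norm power2_less_imp_less)
    qed
    then show ?thesis by blast
  qed
  obtain p where p: "\<And>n. p \<in> N n"
    using decreasing_closed_nest[of N] N_closed N_nonempty N_anti N_small by metis
  have "p \<in> S" using p[of 0] by (simp add: N_def)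
  have p_min: "(norm (x - p))\<^sup>2 \<le> d"
  proof (rule field_le_epsilon)
    fix e :: real assume "e > 0"
    then obtain n where "inverse (real (Suc n)) < e" using reals_Archimedean by blast
    then show "(norm (x - p))\<^sup>2 \<le> d + e" using p[of n] by (simp add: N_def)
  qed
  have "inner (x - p) y = 0" if "y \<in> S" for y
  proof (cases "y = 0")
    case False
    \<comment> \<open>The multiple of \<open>y\<close> nearest to \<open>x - p\<close>.\<close>
    define t where "t = inner (x - p) y / inner y y"
    have "p + t *\<^sub>R y \<in> S"
      using \<open>p \<in> S\<close> that S by (auto intro: subspace_scale subspace_add)
    from d_le[OF this] have "(norm (x - p))\<^sup>2 \<le> (norm ((x - p) - t *\<^sub>R y))\<^sup>2"
      unfolding diff_diff_eq by (rule order_trans[OF p_min])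
    also have "\<dots> = (norm (x - p))\<^sup>2 - 2 * t * inner (x - p) y + t * t * inner y y"
      by (simp add: power2_norm_eq_inner inner_diff_left inner_diff_right inner_commute
          algebra_simps)
    also have "\<dots> = (norm (x - p))\<^sup>2 - (inner (x - p) y)\<^sup>2 / inner y y"
      using False by (simp add: t_def power2_eq_square)
    finally have "(inner (x - p) y)\<^sup>2 / inner y y \<le> 0" by simp
    moreover have "inner y y > 0" using False by simp
    ultimately have "(inner (x - p) y)\<^sup>2 \<le> 0" by (simp add: divide_le_0_iff)
    then show ?thesis by simp
  qed simp
  then show ?thesis using \<open>p \<in> S\<close> by blast
qed

lemma norm_eq_of_cinner_eq:
  assumes "cinner x x = cinner y y"
  shows "norm x = norm y"
  using assms by (simp add: norm_eq_sqrt_inner flip: Re_cinner)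

text \<open>
  The defining description is shown to be satisfiable and unique. Real orthogonality to a complex
  subspace gives complex orthogonality, since the imaginary part of \<open>cinner x y\<close> is the real part
  of \<open>cinner x (\<i> *\<^sub>C y)\<close>.
\<close>

lemma orthogonal_projection_range:
  fixes J :: "'h::separable_complex_hilbert \<Rightarrow> 'k::separable_complex_hilbert"
  assumes "isometric_embedding J"
  shows "orthogonal_projection (range J) x \<in> range J"
    and "y \<in> range J \<Longrightarrow> cinner (x - orthogonal_projection (range J) x) y = 0"
proof -
  have bl: "bounded_linear J" and J_scale: "\<And>c h. J (c *\<^sub>C h) = c *\<^sub>C J h"
    and J_norm: "\<And>h. norm (J h) = norm h"
    using assms by (auto simp: isometric_embedding_def bounded_clinear_def
        intro: norm_eq_of_cinner_eq)
  interpret J: bounded_linear J by (rule bl)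
  have sub: "subspace (range J)"
    using J.linear_axioms by (simp add: linear_subspace_image)
  have "complete (range J)"
    by (rule complete_isometric_image[of 1 UNIV]) (auto simp: bl J_norm complete_UNIV)
  then have cl: "closed (range J)" by (rule complete_imp_closed)
  obtain p where p: "p \<in> range J" and p_re: "\<And>y. y \<in> range J \<Longrightarrow> inner (x - p) y = 0"
    using closed_subspace_projection_exists[OF sub cl] by blast
  have p_orth: "cinner (x - p) y = 0" if "y \<in> range J" for y
  proof (rule complex_eqI)
    have "\<i> *\<^sub>C y \<in> range J" using that by (auto simp flip: J_scale)
    then have "Re (cinner (x - p) (\<i> *\<^sub>C y)) = 0" by (simp add: Re_cinner p_re)
    moreover have "cinner (x - p) (\<i> *\<^sub>C y) = - \<i> * cinner (x - p) y"
      by (metis cinner_commute cinner_scaleC_left complex_cnj_i complex_cnj_mult)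
    ultimately show "Im (cinner (x - p) y) = Im 0" by simp
  qed (simp add: Re_cinner p_re that)
  have uniq: "q = p" if q: "q \<in> range J" "\<forall>y\<in>range J. cinner (x - q) y = 0" for q
  proof -
    have qp: "q - p \<in> range J" using subspace_diff[OF sub q(1) p] .
    have "inner (x - p) (q - p) = 0" by (rule p_re[OF qp])
    moreover have "inner (x - q) (q - p) = 0"
      using q(2)[rule_format, OF qp] by (simp flip: Re_cinner)
    ultimately have "inner (q - p) (q - p) = 0" by (simp add: inner_diff_left)
    then show ?thesis by simp
  qed
  have "orthogonal_projection (range J) x = p"
    unfolding orthogonal_projection_def
  proof (rule the_equality)
    show "p \<in> range J \<and> (\<forall>y\<in>range J. cinner (x - p) y = 0)"
      using p p_orth by blast
  qed (use uniq in blast)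
  then show "orthogonal_projection (range J) x \<in> range J"
    and "y \<in> range J \<Longrightarrow> cinner (x - orthogonal_projection (range J) x) y = 0"
    using p p_orth by simp_all
qed

text \<open>
  Pythagoras for \<open>x = p + (x - p)\<close>. Stating it for any \<open>p\<close> with orthogonal error lets it apply to
  a linear combination of projections directly.
\<close>

lemma norm_le_of_cinner_diff_eq_0:
  assumes "cinner (x - p) p = 0"
  shows "norm p \<le> norm x"
proof -
  have "inner (x - p) p = 0" using assms by (simp flip: Re_cinner)
  then have "(norm p)\<^sup>2 \<le> norm x * norm p"
    using norm_cauchy_schwarz[of x p] by (simp add: inner_diff_left power2_norm_eq_inner)
  then show ?thesis
    by (cases "norm p = 0") (auto simp: power2_eq_square)
qed

section \<open>Norm estimates for dilations\<close>

lemma bounded_clinear_add_scaleC: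
  assumes "bounded_clinear X" and "bounded_clinear Y"
  shows "bounded_linear (\<lambda>x. X x + c *\<^sub>C Y x)"
proof -
  have norm_scaleC: "norm (c *\<^sub>C z) = cmod c * norm z" for z :: 'b
  proof -
    have "cinner (a *\<^sub>C z) (a *\<^sub>C z) = of_real ((cmod a)\<^sup>2) * cinner z z" for a
      by (metis cinner_commute cinner_scaleC_left complex_cnj_mult complex_norm_square
          mult.assoc)
    from this[of c] this[of "of_real (cmod c)"]
    have "cinner (c *\<^sub>C z) (c *\<^sub>C z) = cinner (cmod c *\<^sub>R z) (cmod c *\<^sub>R z)"
      by (simp add: scaleC_of_real)
    from norm_eq_of_cinner_eq[OF this] show ?thesis by simp
  qed
  have "bounded_linear (\<lambda>z::'b. c *\<^sub>C z)"
  proof (rule bounded_linear_intro[where K = "cmod c"])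
    show "c *\<^sub>C (r *\<^sub>R z) = r *\<^sub>R (c *\<^sub>C z)" for r and z :: 'b
      by (metis mult.commute scaleC_of_real scaleC_scaleC)
  qed (simp_all add: scaleC_add_right norm_scaleC mult.commute)
  then have "bounded_linear (\<lambda>x. c *\<^sub>C Y x)"
    by (rule bounded_linear_compose) (use assms in \<open>simp add: bounded_clinear_def\<close>)
  with assms(1) show ?thesis
    by (simp add: bounded_clinear_def bounded_linear_add)
qed

lemma unitary_onorm_le:
  assumes "unitary U"
  shows "onorm U \<le> 1"
proof (rule onorm_bound)
  have "norm (U x) = norm x" for x
    using assms by (auto simp: unitary_def intro: norm_eq_of_cinner_eq)
  then show "norm (U x) \<le> 1 * norm x" for x by simp
qed simp

text \<open>
  Up to the factor \<open>\<rho>\<close>, the vector \<open>T h + c A h\<close> is the projection of \<open>U h + c V h\<close>: the first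
  powers of both dilations are compressed by the same projection, and the errors of the two
  compressions combine linearly to a vector still orthogonal to \<open>H\<close>.
\<close>

lemma onorm_pencil_le_dilation:
  fixes J :: "'h::separable_complex_hilbert \<Rightarrow> 'k::separable_complex_hilbert"
  assumes "\<rho> > 0" and dT: "unitary_rho_dilation \<rho> J T U" and dA: "unitary_rho_dilation \<rho> J A V"
  shows "onorm (\<lambda>h. T h + c *\<^sub>C A h) \<le> \<rho> * onorm (\<lambda>x. U x + c *\<^sub>C V x)"
proof (rule onorm_bound)
  have iso: "isometric_embedding J" using dT by (simp add: unitary_rho_dilation_def)
  have J_bl: "bounded_linear J" and J_scale: "\<And>c h. J (c *\<^sub>C h) = c *\<^sub>C J h"
    and J_norm: "\<And>h. norm (J h) = norm h"
    using iso by (auto simp: isometric_embedding_def bounded_clinear_def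
        intro: norm_eq_of_cinner_eq)
  interpret J: bounded_linear J by (rule J_bl)
  have bl: "bounded_linear (\<lambda>x. U x + c *\<^sub>C V x)"
    using dT dA by (intro bounded_clinear_add_scaleC)
      (auto simp: unitary_rho_dilation_def unitary_def)
  show "0 \<le> \<rho> * onorm (\<lambda>x. U x + c *\<^sub>C V x)"
    using \<open>\<rho> > 0\<close> onorm_pos_le[OF bl] by simp
  fix h
  let ?P = "orthogonal_projection (range J)"
  define p where "p = ?P (U (J h)) + c *\<^sub>C ?P (V (J h))"
  define x where "x = U (J h) + c *\<^sub>C V (J h)"
  have JT: "J (T h) = \<rho> *\<^sub>R ?P (U (J h))"
    using dT unfolding unitary_rho_dilation_def 
    by (auto dest: spec[of _ 1])
  have JA: "J (A h) = \<rho> *\<^sub>R ?P (V (J h))"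
    using dA unfolding unitary_rho_dilation_def 
    by (auto dest: spec[of _ 1])
  have J_pencil: "J (T h + c *\<^sub>C A h) = \<rho> *\<^sub>R p"
    by (simp add: J.add J_scale JT JA p_def scaleR_add_right)
      (metis mult.commute scaleC_of_real scaleC_scaleC)
  have "p \<in> range J"
  proof -
    obtain a b where "?P (U (J h)) = J a" "?P (V (J h)) = J b"
      using orthogonal_projection_range(1)[OF iso] by (metis imageE)
    then have "p = J (a + c *\<^sub>C b)" by (simp add: p_def J.add J_scale)
    then show ?thesis by simp
  qed
  have split: "x - p = (U (J h) - ?P (U (J h))) + c *\<^sub>C (V (J h) - ?P (V (J h)))"
  proof -
    have "c *\<^sub>C (V (J h) - ?P (V (J h))) + c *\<^sub>C ?P (V (J h)) = c *\<^sub>C V (J h)"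
      by (simp flip: scaleC_add_right)
    then show ?thesis by (simp add: x_def p_def algebra_simps)
  qed
  have "cinner (x - p) p = 0"
    unfolding split
    by (simp add: cinner_add_left cinner_scaleC_left
        orthogonal_projection_range(2)[OF iso \<open>p \<in> range J\<close>])
  then have "norm p \<le> norm x" by (rule norm_le_of_cinner_diff_eq_0)
  also have "\<dots> \<le> onorm (\<lambda>x. U x + c *\<^sub>C V x) * norm h"
    unfolding x_def using onorm[OF bl, of "J h"] by (simp add: J_norm)
  finally have "\<rho> * norm p \<le> \<rho> * (onorm (\<lambda>x. U x + c *\<^sub>C V x) * norm h)"
    using \<open>\<rho> > 0\<close> by simp
  moreover have "norm (T h + c *\<^sub>C A h) = \<rho> * norm p"
    using J_norm[of "T h + c *\<^sub>C A h"] \<open>\<rho> > 0\<close> by (simp add: J_pencil)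
  ultimately show "norm (T h + c *\<^sub>C A h) \<le> \<rho> * onorm (\<lambda>x. U x + c *\<^sub>C V x) * norm h"
    by (simp only: mult.assoc)
qed

section \<open>Birkhoff-James orthogonality of the dilations\<close>

theorem theorem4p1:
  fixes \<rho> :: real
    and T A :: "'h::separable_complex_hilbert \<Rightarrow> 'h"
    and J :: "'h \<Rightarrow> 'k::separable_complex_hilbert"
    and U\<^sub>T U\<^sub>A :: "'k \<Rightarrow> 'k"
  assumes "\<rho> > 0"
    and "bounded_clinear T" and "bounded_clinear A"
    and "T \<in> zeta_class TYPE('k1::separable_complex_hilbert) \<rho>"
    and "A \<in> zeta_class TYPE('k2::separable_complex_hilbert) \<rho>"
    and "onorm T = \<rho>"
    and "isometric_embedding J"
    and "unitary_rho_dilation \<rho> J T U\<^sub>T"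
    and "unitary_rho_dilation \<rho> J A U\<^sub>A"
    and "T \<bottom>\<^sub>B A"
  shows "U\<^sub>T \<bottom>\<^sub>B U\<^sub>A"
  unfolding bj_orthogonal_def
proof
  fix c
  have "\<rho> \<le> onorm (\<lambda>h. T h + c *\<^sub>C A h)"
    using assms(6,10) by (auto simp: bj_orthogonal_def)
  also have "\<dots> \<le> \<rho> * onorm (\<lambda>x. U\<^sub>T x + c *\<^sub>C U\<^sub>A x)"
    using onorm_pencil_le_dilation[OF assms(1,8,9)] .
  finally have "1 \<le> onorm (\<lambda>x. U\<^sub>T x + c *\<^sub>C U\<^sub>A x)"
    using \<open>\<rho> > 0\<close> by simp
  moreover have "onorm U\<^sub>T \<le> 1"
    using assms(8) by (intro unitary_onorm_le) (simp add: unitary_rho_dilation_def)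
  ultimately show "onorm U\<^sub>T \<le> onorm (\<lambda>x. U\<^sub>T x + c *\<^sub>C U\<^sub>A x)" by simp
qed

end
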